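(* Let $\mathbb K$ be a proper ordered field extension of $\mathbb R$, let $\gamma>0$ be a limited element of $\mathbb K$ and let $f_\gamma:(F,\delta,\Delta)\to(F_\gamma,\delta_\gamma,\Delta_\gamma)$ be a $\gamma$-contraction of galactic spaces (over $\mathbb K$). Equip $F$ and $F_\gamma$ with the topologies defined by the generalized distances $\delta$ and $\delta_\gamma$, and the sets of metric components $\mathcal M_F$ and $\mathcal M_{F_\gamma}$ with the topologies defined by the galactic distances $\Delta$ and $\Delta_\gamma$. Then: 1. The maps $f_\gamma:F\to F_\gamma$ and $\widetilde f_\gamma:\mathcal M_F\to\mathcal M_{F_\gamma}$ are continuous. 2. If $\gamma\not\simeq 0$, then $f_\gamma$ and $\widetilde f_\gamma$ are homeomorphisms. 3. If $\gamma\simeq 0$, then for every $z\in F_\gamma$ the set $f_\gamma^{-1}(\{z\})$ is an open set of $F$. 4. If $\gamma\simeq 0$ and if there exists $\eta\in\mathbb K$ with $\eta>0$, $\eta\simeq 0$ and $\gamma/\eta\simeq 0$, then for every $Z\in\mathcal M_{F_\gamma}$ the set $\widetilde f_\gamma^{-1}(\{Z\})$ is an open set of $\mathcal M_F$.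
   Context: A proper ordered field extension $\mathbb K$ of $\mathbb R$ is an ordered field with $\mathbb R\subsetneq\mathbb K$ whose ordered field structure restricts to the usual one on $\mathbb R$. An element $s\in\mathbb K$ is infinitely small ($s\simeq 0$) if $|s|<1/n$ for all integers $n\ge 1$, infinitely large if $|s|>n$ for all $n\in\mathbb N$ (written $s\simeq+\infty$ if $s>0$, $s\simeq-\infty$ if $s<0$), and limited if it is not infinitely large. $\mathrm{Hal}(0)$ is the additive subgroup of infinitely small elements, and $s\simeq t$ means $s-t\in \mathrm{Hal}(0)$. $\mathrm{Gal}(0)$ is the additive subgroup of limited elements; $\mathrm{Gal}(\mathbb K)=\mathbb K/\mathrm{Gal}(0)$, and $\mathrm{Gal}:\mathbb K\to\mathrm{Gal}(\mathbb K)$ is the canonical projection. $\mathrm{Gal}(\mathbb K)$ is a totally ordered additive group for: $\mathrm{Gal}(s)\le\mathrm{Gal}(t)$ iff $s\le t$ or $s-t\in\mathrm{Gal}(0)$. For each limited $s$ there is a unique real ${}^o s$ with $s\simeq{}^o s$; the principal value map $\mathrm{pv}:\mathbb K\to\mathbb R\cup\{\pm\infty\}$ sends limited $s$ to ${}^o s$ and $s\simeq\pm\infty$ to $\pm\infty$. For an ordered additive group $G$, $G_+=\{x\in G: x\ge 0\}$; the symbol $+\infty$ satisfies $x<+\infty$ and $x+(+\infty)=(+\infty)+x=+\infty$. A map $d$ on $X\times X$ with values in $G_+$ or $G_+\cup\{+\infty\}$ satisfies the general metric rule if for all $x,y,z\in X$: $d(x,x)=0$; $d(x,y)=d(y,x)>0$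 if $x\ne y$; $d(x,z)\le d(x,y)+d(y,z)$. A generalized distance on a set $F$ is a map $\delta:F\times F\to\mathbb R_+\cup\{+\infty\}$ satisfying the general metric rule. The metric components of $F$ for $\delta$ are the equivalence classes of the relation $\delta(x,y)<+\infty$; $\mathcal M_F$ is the set of metric components and $C_F(x)$ is the one containing $x$. A galactic distance on a set $\mathcal E$ is a map $\Delta:\mathcal E\times\mathcal E\to\mathrm{Gal}(\mathbb K)_+$ satisfying the general metric rule. A galactic space is a triple $(F,\delta,\Delta)$ with $F$ a set, $\delta$ a generalized distance on $F$ and $\Delta$ a galactic distance on $\mathcal M_F$. The topology defined by a generalized distance $\delta$ on $F$ has as basis the open balls $\{y:\delta(x,y)<r\}$, $x\in F$, $r\in\mathbb R_+\cup\{+\infty\}$, $r>0$. The topology defined by a galactic distance $\Delta$ on $\mathcal E$ has as basis the open balls $\{H\in\mathcal E:\Delta(E,H)<\rho\}$, $E\in\mathcal E$, $\rho\in\mathrm{Gal}(\mathbb K)$, $\rho>0$. For limited $\gamma>0$ in $\mathbb K$ and $\tau=\mathrm{Gal}(t)\in\mathrm{Gal}(\mathbb K)$, put $\gamma.\tau=\{\gamma s: s\in\tau\}\subset\mathbb K$ and $\gamma\bullet\tau=\mathrm{Gal}(\gamma t)\in\mathrm{Gal}(\mathbb K)$. If $\tau>0$, $\mathrm{pv}$ is constant on $\gamma.\tau$ and its value is denoted $\mathrm{pv}(\gamma.\tau)$. A morphism $(F,\delta,\Delta)\to(F',\delta',\Delta')$ is a map $f:F\to F'$ for which there is a limited $\gamma>0$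 in $\mathbb K$ with (1) $\delta'(f(x_1),f(x_2))\le\gamma\,\delta(x_1,x_2)$ for all $x_1,x_2\in F$ (with $a\le+\infty$ and $\gamma\cdot(+\infty)=+\infty$), so that for each $E\in\mathcal M_F$ the image $f(E)$ lies in a unique metric component of $F'$, denoted $f[E]=\widetilde f(E)$, which defines $\widetilde f:\mathcal M_F\to\mathcal M_{F'}$; and (2) $\Delta'(f[E_1],f[E_2])\le\gamma\bullet\Delta(E_1,E_2)$ for all $E_1,E_2\in\mathcal M_F$. For limited $\gamma>0$ in $\mathbb K$, a $\gamma$-contraction of $(F,\delta,\Delta)$ is a morphism $f:(F,\delta,\Delta)\to(F',\delta',\Delta')$ that is surjective as a map $F\to F'$ and such that for all $x_1,x_2\in F$ and $E_1,E_2\in\mathcal M_F$: $\delta'(f(x_1),f(x_2))=\mathrm{pv}(\gamma\,\delta(x_1,x_2))$ if $\delta(x_1,x_2)<+\infty$; $\delta'(f(x_1),f(x_2))=\mathrm{pv}(\gamma.\Delta(C_F(x_1),C_F(x_2)))$ if $\delta(x_1,x_2)=+\infty$; and $\Delta'(f[E_1],f[E_2])=\gamma\bullet\Delta(E_1,E_2)$. *)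

theory Defs
  imports "HOL-Analysis.Analysis"
begin

section \<open>Ordered field extensions of the reals\<close>

text \<open>
  An ordered field extension of the reals is a type of sort
  \<open>{linordered_field, real_algebra_1}\<close>, with \<open>of_real\<close> as the embedding. This map is a homomorphism
  of fields, so it preserves the order (a nonnegative real is a square). The extension is proper
  when \<open>of_real\<close> is not surjective.
\<close>

lemma of_real_le_iff_ordered_extension:
  "(of_real a :: 'k::{linordered_field, real_algebra_1}) \<le> of_real b \<longleftrightarrow> a \<le> b"
proof -
  have mono: "(of_real x :: 'k) \<le> of_real y" if "x \<le> y" for x y
  proof -
    have "of_real y - of_real x = (of_real (sqrt (y - x)) :: 'k) * of_real (sqrt (y - x))"
      using that by (simp flip: of_real_mult of_real_diff)
    then have "0 \<le> (of_real y - of_real x :: 'k)"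
      by simp
    then show ?thesis by simp
  qed
  show ?thesis
    using mono[of a b] mono[of b a] by (metis antisym linear of_real_eq_iff)
qed

definition proper_real_extension :: "'k::{linordered_field, real_algebra_1} itself \<Rightarrow> bool" where
  "proper_real_extension _ \<longleftrightarrow> range (of_real :: real \<Rightarrow> 'k) \<noteq> UNIV"

definition infinitely_small :: "'k::linordered_field \<Rightarrow> bool" where
  "infinitely_small s \<longleftrightarrow> (\<forall>n::nat. n \<ge> 1 \<longrightarrow> \<bar>s\<bar> < 1 / of_nat n)"

definition infinitely_large :: "'k::linordered_field \<Rightarrow> bool" where
  "infinitely_large s \<longleftrightarrow> (\<forall>n::nat. \<bar>s\<bar> > of_nat n)"

definition limited :: "'k::linordered_field \<Rightarrow> bool" where
  "limited s \<longleftrightarrow> \<not> infinitely_large s"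

definition infinitely_close :: "'k::linordered_field \<Rightarrow> 'k \<Rightarrow> bool"  (infix \<open>\<simeq>\<close> 50) where
  "s \<simeq> t \<longleftrightarrow> infinitely_small (s - t)"

definition standard_part :: "'k::{linordered_field, real_algebra_1} \<Rightarrow> real" where
  "standard_part s = (THE r. s \<simeq> of_real r)"

definition pv :: "'k::{linordered_field, real_algebra_1} \<Rightarrow> ereal" where
  "pv s = (if limited s then ereal (standard_part s) else if s > 0 then \<infinity> else - \<infinity>)"

lemma limited_iff: "limited s \<longleftrightarrow> (\<exists>n::nat. \<bar>s\<bar> \<le> of_nat n)"
  by (auto simp: limited_def infinitely_large_def not_less)

lemma limited_0 [simp]: "limited 0"
  unfolding limited_iff by (rule exI[of _ 0]) simp

lemma limited_minus [simp]: "limited (- s) \<longleftrightarrow> limited s"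
  by (simp add: limited_iff)

lemma limited_add:
  assumes "limited s" "limited t" shows "limited (s + t)"
proof -
  obtain m n :: nat where "\<bar>s\<bar> \<le> of_nat m" "\<bar>t\<bar> \<le> of_nat n"
    using assms by (auto simp: limited_iff)
  then have "\<bar>s + t\<bar> \<le> of_nat (m + n)"
    using abs_triangle_ineq[of s t] by simp
  then show ?thesis by (auto simp only: limited_iff)
qed

lemma limited_mult:
  assumes "limited s" "limited t" shows "limited (s * t)"
proof -
  obtain m n :: nat where "\<bar>s\<bar> \<le> of_nat m" "\<bar>t\<bar> \<le> of_nat n"
    using assms by (auto simp: limited_iff)
  then have "\<bar>s * t\<bar> \<le> of_nat (m * n)"
    by (simp add: abs_mult mult_mono)
  then show ?thesis by (auto simp only: limited_iff)
qed

lemma limited_diff_commute: "limited (s - t) \<longleftrightarrow> limited (t - s)"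
  using limited_minus[of "s - t"] by simp

lemma limited_between:
  assumes "limited a" "limited b" "a \<le> s" "s \<le> b" shows "limited s"
proof -
  obtain m n :: nat where mn: "\<bar>a\<bar> \<le> of_nat m" "\<bar>b\<bar> \<le> of_nat n"
    using assms by (auto simp: limited_iff)
  have "(0::'a) \<le> of_nat m" "(0::'a) \<le> of_nat n"
    by simp_all
  with mn assms(3,4) have "\<bar>s\<bar> \<le> of_nat (m + n)"
    by (simp add: abs_le_iff)
  then show ?thesis by (auto simp only: limited_iff)
qed

section \<open>The ordered group of galaxies\<close>

quotient_type (overloaded) 'k galaxy = "'k::linordered_field" / "\<lambda>s t. limited (s - t)"
  morphisms rep_galaxy Gal
proof (rule equivpI)
  show "reflp (\<lambda>s t :: 'k. limited (s - t))"
    by (simp add: reflp_def)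
  show "symp (\<lambda>s t :: 'k. limited (s - t))"
    by (simp add: symp_def limited_diff_commute)
  show "transp (\<lambda>s t :: 'k. limited (s - t))"
  proof (rule transpI)
    fix s t u :: 'k assume "limited (s - t)" "limited (t - u)"
    from limited_add[OF this] show "limited (s - u)" by simp
  qed
qed

lemma Gal_eq_iff: "Gal s = Gal t \<longleftrightarrow> limited (s - t)"
  by (rule galaxy.abs_eq_iff)

instantiation galaxy :: (linordered_field) linordered_ab_group_add
begin

lift_definition zero_galaxy :: "'a galaxy" is 0 .

lift_definition plus_galaxy :: "'a galaxy \<Rightarrow> 'a galaxy \<Rightarrow> 'a galaxy" is "(+)"
  subgoal for s s' t t' using limited_add[of "s - s'" "t - t'"] by (simp add: algebra_simps)
  done

lift_definition uminus_galaxy :: "'a galaxy \<Rightarrow> 'a galaxy" is uminus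
  by (simp add: limited_diff_commute)

lift_definition minus_galaxy :: "'a galaxy \<Rightarrow> 'a galaxy \<Rightarrow> 'a galaxy" is "(-)"
  subgoal for s s' t t' using limited_add[of "s - s'" "t' - t"]
    by (simp add: algebra_simps limited_diff_commute)
  done

lift_definition less_eq_galaxy :: "'a galaxy \<Rightarrow> 'a galaxy \<Rightarrow> bool"
  is "\<lambda>s t. s \<le> t \<or> limited (s - t)"
proof -
  have *: "s' \<le> t' \<or> limited (s' - t')"
    if "limited (s - s')" "limited (t - t')" "s \<le> t \<or> limited (s - t)" for s s' t t' :: 'a
  proof (cases "s' \<le> t'")
    case False
    have st: "limited ((s' - s) + (t - t'))"
      using that by (intro limited_add) (simp_all add: limited_diff_commute)
    show ?thesis
    proof (cases "s \<le> t")
      case True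
      with False have "limited (s' - t')"
        by (intro limited_between[OF limited_0 st]) simp_all
      then show ?thesis ..
    next
      case False
      with that(3) have "limited (s - t)" by simp
      from limited_add[OF st this] show ?thesis by simp
    qed
  qed simp
  show "(s \<le> t \<or> limited (s - t)) = (s' \<le> t' \<or> limited (s' - t'))"
    if "limited (s - s')" "limited (t - t')" for s s' t t' :: 'a
    using *[of s s' t t'] *[of s' s t' t] that by (auto simp: limited_diff_commute)
qed

definition less_galaxy :: "'a galaxy \<Rightarrow> 'a galaxy \<Rightarrow> bool" where
  "less_galaxy \<sigma> \<tau> \<longleftrightarrow> \<sigma> \<le> \<tau> \<and> \<not> \<tau> \<le> \<sigma>"

instance
proof
  fix a b c :: "'a galaxy"
  show "a + b + c = a + (b + c)" by transfer (simp add: algebra_simps)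
  show "a + b = b + a" by transfer (simp add: algebra_simps)
  show "0 + a = a" by transfer simp
  show "- a + a = 0" by transfer simp
  show "a - b = a + - b" by transfer simp
  show "(a < b) = (a \<le> b \<and> \<not> b \<le> a)" by (rule less_galaxy_def)
  show "a \<le> a" by transfer simp
  show "a \<le> b \<or> b \<le> a" by transfer auto
  show "a \<le> b \<Longrightarrow> c + a \<le> c + b" by transfer simp
  show "a = b" if "a \<le> b" "b \<le> a" using that
  proof transfer
    fix s t :: 'a
    assume "s \<le> t \<or> limited (s - t)" "t \<le> s \<or> limited (t - s)"
    then show "limited (s - t)"
      by (metis antisym diff_self limited_0 limited_diff_commute)
  qed
  show "a \<le> c" if "a \<le> b" "b \<le> c" using that
  proof transfer
    fix s t u :: 'a
    assume st: "s \<le> t \<or> limited (s - t)" and tu: "t \<le> u \<or> limited (t - u)"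
    show "s \<le> u \<or> limited (s - u)"
    proof (cases "s \<le> u")
      case False
      consider "s \<le> t" "t \<le> u" | "s \<le> t" "limited (t - u)"
        | "limited (s - t)" "t \<le> u" | "limited (s - t)" "limited (t - u)"
        using st tu by blast
      then have "limited (s - u)"
      proof cases
        case 1 with False show ?thesis by simp
      next
        case 2
        with False show ?thesis by (intro limited_between[OF limited_0 2(2)]) simp_all
      next
        case 3
        with False show ?thesis by (intro limited_between[OF limited_0 3(1)]) simp_all
      next
        case 4
        from limited_add[OF this] show ?thesis by simp
      qed
      then show ?thesis ..
    qed simp
  qed
qed

end

lemma Gal_le_iff: "Gal s \<le> Gal t \<longleftrightarrow> s \<le> t \<or> limited (s - t)"
  by (rule less_eq_galaxy.abs_eq)

definition gal_mult_set :: "'k::linordered_field \<Rightarrow> 'k galaxy \<Rightarrow> 'k set" where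
  "gal_mult_set \<gamma> \<tau> = {\<gamma> * s | s. Gal s = \<tau>}"

text \<open>Independent of the representative for limited \<open>\<gamma>\<close>: see \<open>gal_scale_Gal\<close>.\<close>

definition gal_scale :: "'k::linordered_field \<Rightarrow> 'k galaxy \<Rightarrow> 'k galaxy"  (infixr \<open>\<bullet>\<^sub>G\<close> 75) where
  "\<gamma> \<bullet>\<^sub>G \<tau> = Gal (\<gamma> * rep_galaxy \<tau>)"

lemma Gal_rep_galaxy [simp]: "Gal (rep_galaxy \<tau>) = \<tau>"
  by (rule Quotient3_abs_rep[OF Quotient3_galaxy])

lemma gal_scale_Gal:
  assumes "limited \<gamma>" shows "\<gamma> \<bullet>\<^sub>G Gal t = Gal (\<gamma> * t)"
proof -
  have "limited (rep_galaxy (Gal t) - t)"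
    by (simp flip: Gal_eq_iff)
  from limited_mult[OF assms this] show ?thesis
    by (simp add: gal_scale_def Gal_eq_iff algebra_simps)
qed

text \<open>The common value of \<open>pv\<close> on a set on which it is constant.\<close>

definition pv_set :: "'k::{linordered_field, real_algebra_1} set \<Rightarrow> ereal" where
  "pv_set A = (THE v. pv ` A = {v})"

section \<open>Galactic spaces\<close>

text \<open>
  Generalized distances take values in \<open>ereal\<close> and galactic distances in \<open>'k galaxy\<close>;
  the common target sort below covers both.
\<close>

definition general_metric_rule ::
  "'a set \<Rightarrow> ('a \<Rightarrow> 'a \<Rightarrow> 'g::{comm_monoid_add, linorder}) \<Rightarrow> bool" where
  "general_metric_rule X d \<longleftrightarrow>
     (\<forall>x\<in>X. \<forall>y\<in>X. d x y \<ge> 0) \<and>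
     (\<forall>x\<in>X. d x x = 0) \<and>
     (\<forall>x\<in>X. \<forall>y\<in>X. x \<noteq> y \<longrightarrow> d x y = d y x \<and> d x y > 0) \<and>
     (\<forall>x\<in>X. \<forall>y\<in>X. \<forall>z\<in>X. d x z \<le> d x y + d y z)"

definition generalized_distance :: "'a set \<Rightarrow> ('a \<Rightarrow> 'a \<Rightarrow> ereal) \<Rightarrow> bool" where
  "generalized_distance F \<delta> \<longleftrightarrow> general_metric_rule F \<delta>"

definition galactic_distance :: "'a set \<Rightarrow> ('a \<Rightarrow> 'a \<Rightarrow> 'k::linordered_field galaxy) \<Rightarrow> bool" where
  "galactic_distance X \<Delta> \<longleftrightarrow> general_metric_rule X \<Delta>"

definition finite_distance_rel :: "'a set \<Rightarrow> ('a \<Rightarrow> 'a \<Rightarrow> ereal) \<Rightarrow> ('a \<times> 'a) set" where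
  "finite_distance_rel F \<delta> = {(x, y). x \<in> F \<and> y \<in> F \<and> \<delta> x y < \<infinity>}"

definition metric_components :: "'a set \<Rightarrow> ('a \<Rightarrow> 'a \<Rightarrow> ereal) \<Rightarrow> 'a set set" where
  "metric_components F \<delta> = F // finite_distance_rel F \<delta>"

definition component_of_point :: "'a set \<Rightarrow> ('a \<Rightarrow> 'a \<Rightarrow> ereal) \<Rightarrow> 'a \<Rightarrow> 'a set" where
  "component_of_point F \<delta> x = finite_distance_rel F \<delta> `` {x}"

definition galactic_space ::
  "'a set \<Rightarrow> ('a \<Rightarrow> 'a \<Rightarrow> ereal) \<Rightarrow> ('a set \<Rightarrow> 'a set \<Rightarrow> 'k::linordered_field galaxy) \<Rightarrow> bool" where
  "galactic_space F \<delta> \<Delta> \<longleftrightarrow>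
     generalized_distance F \<delta> \<and> galactic_distance (metric_components F \<delta>) \<Delta>"

lemma equiv_finite_distance_rel:
  assumes "generalized_distance F \<delta>" shows "equiv F (finite_distance_rel F \<delta>)"
proof (rule equivI)
  have rule: "general_metric_rule F \<delta>"
    using assms by (simp add: generalized_distance_def)
  show "finite_distance_rel F \<delta> \<subseteq> F \<times> F"
    by (auto simp: finite_distance_rel_def)
  show "refl_on F (finite_distance_rel F \<delta>)"
    using rule by (auto simp: refl_on_def finite_distance_rel_def general_metric_rule_def)
  show "sym (finite_distance_rel F \<delta>)"
    using rule unfolding sym_def finite_distance_rel_def general_metric_rule_def
    by (metis (mono_tags, lifting) case_prodD case_prodI mem_Collect_eq)
  show "trans (finite_distance_rel F \<delta>)"
  proof (rule transI)
    fix x y z assume "(x, y) \<in> finite_distance_rel F \<delta>" "(y, z) \<in> finite_distance_rel F \<delta>"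
    then have F: "x \<in> F" "y \<in> F" "z \<in> F" and lt: "\<delta> x y < \<infinity>" "\<delta> y z < \<infinity>"
      by (auto simp: finite_distance_rel_def)
    have "\<delta> x z \<le> \<delta> x y + \<delta> y z"
      using rule F by (auto simp: general_metric_rule_def)
    also have "\<dots> < \<infinity>"
      using lt by simp
    finally show "(x, z) \<in> finite_distance_rel F \<delta>"
      using F by (simp add: finite_distance_rel_def)
  qed
qed

text \<open>
  For a generalized distance the radius ranges over the positive elements of \<open>ereal\<close>, including
  \<open>\<infinity>\<close>; for a galactic distance over the positive galaxies.
\<close>

definition is_open_ball ::
  "'a set \<Rightarrow> ('a \<Rightarrow> 'a \<Rightarrow> 'g::{comm_monoid_add, linorder}) \<Rightarrow> 'a set \<Rightarrow> bool" where
  "is_open_ball X d B \<longleftrightarrow> (\<exists>x\<in>X. \<exists>r>0. B = {y \<in> X. d x y < r})"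

definition distance_topology ::
  "'a set \<Rightarrow> ('a \<Rightarrow> 'a \<Rightarrow> 'g::{comm_monoid_add, linorder}) \<Rightarrow> 'a topology" where
  "distance_topology X d = topology (arbitrary union_of is_open_ball X d)"

text \<open>The open balls do form a basis, so the definition above is meaningful.\<close>

lemma openin_distance_topology_aux:
  fixes d :: "'a \<Rightarrow> 'a \<Rightarrow> 'g::{comm_monoid_add, linorder}"
  assumes rule: "general_metric_rule X d"
    and gap: "\<And>a r :: 'g. 0 \<le> a \<Longrightarrow> a < r \<Longrightarrow> \<exists>s>0. \<forall>b<s. a + b < r"
  shows "openin (distance_topology X d) = arbitrary union_of is_open_ball X d"
  unfolding distance_topology_def
proof (rule topology_inverse', rule istopology_base_eq[THEN iffD2], intro allI impI)
  have refl: "d x x = 0" if "x \<in> X" for x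
    using rule that by (auto simp: general_metric_rule_def)
  have nonneg: "0 \<le> d x y" if "x \<in> X" "y \<in> X" for x y
    using rule that by (auto simp: general_metric_rule_def)
  have tri: "d x z \<le> d x y + d y z" if "x \<in> X" "y \<in> X" "z \<in> X" for x y z
    using rule that by (auto simp: general_metric_rule_def)
  have centre: "\<exists>s>0. {z \<in> X. d y z < s} \<subseteq> B" if B: "is_open_ball X d B" and y: "y \<in> B" for B y
  proof -
    obtain x r where x: "x \<in> X" and Br: "B = {y \<in> X. d x y < r}"
      using B by (auto simp: is_open_ball_def)
    have yX: "y \<in> X" and xy: "d x y < r"
      using y by (auto simp: Br)
    obtain s where s: "s > 0" "\<forall>b<s. d x y + b < r"
      using gap[OF nonneg[OF x yX] xy] by blast
    have "{z \<in> X. d y z < s} \<subseteq> B"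
      using s(2) tri[OF x yX] by (force simp: Br intro: le_less_trans)
    with s(1) show ?thesis by blast
  qed
  have sub: "B \<subseteq> X" if "is_open_ball X d B" for B
    using that by (auto simp: is_open_ball_def)
  fix S T assume ST: "is_open_ball X d S \<and> is_open_ball X d T"
  show "(arbitrary union_of is_open_ball X d) (S \<inter> T)"
    unfolding arbitrary_union_of_alt
  proof
    fix y assume y: "y \<in> S \<inter> T"
    obtain s t where s: "s > 0" "{z \<in> X. d y z < s} \<subseteq> S" and t: "t > 0" "{z \<in> X. d y z < t} \<subseteq> T"
      using centre[of S y] centre[of T y] ST y by blast
    have yX: "y \<in> X" using sub[of S] ST y by blast
    have "min s t > 0" using s(1) t(1) by simp
    moreover have "{z \<in> X. d y z < min s t} \<subseteq> S \<inter> T"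
      using s(2) t(2) by auto
    moreover have "is_open_ball X d {z \<in> X. d y z < min s t}"
      unfolding is_open_ball_def using yX \<open>min s t > 0\<close> by blast
    moreover have "y \<in> {z \<in> X. d y z < min s t}"
      using yX refl[OF yX] s(1) t(1) by simp
    ultimately
    show "\<exists>U. is_open_ball X d U \<and> y \<in> U \<and> U \<subseteq> S \<inter> T" by blast
  qed
qed

lemma openin_generalized_distance_topology:
  assumes "generalized_distance F \<delta>"
  shows "openin (distance_topology F \<delta>) = arbitrary union_of is_open_ball F \<delta>"
proof (rule openin_distance_topology_aux)
  show "general_metric_rule F \<delta>"
    using assms by (simp add: generalized_distance_def)
  show "\<exists>s>0. \<forall>b<s. a + b < r" if "0 \<le> a" "a < r" for a r :: ereal
  proof (intro exI[of _ "r - a"] conjI allI impI)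
    show "r - a > 0" using that by (cases a; cases r) auto
    show "a + b < r" if "b < r - a" for b
      using that \<open>0 \<le> a\<close> \<open>a < r\<close> by (cases a; cases b; cases r) auto
  qed
qed

lemma openin_galactic_distance_topology:
  assumes "galactic_distance X \<Delta>"
  shows "openin (distance_topology X \<Delta>) = arbitrary union_of is_open_ball X \<Delta>"
proof (rule openin_distance_topology_aux)
  show "general_metric_rule X \<Delta>"
    using assms by (simp add: galactic_distance_def)
  show "\<exists>s>0. \<forall>b<s. a + b < r" if "a < r" for a r :: "'b galaxy"
    using that by (intro exI[of _ "r - a"]) (auto simp: less_diff_eq add.commute)
qed

section \<open>Morphisms and contractions\<close>

text \<open>
  \<open>scaled_le \<gamma> a b\<close> is the inequality \<open>a \<le> \<gamma> b\<close> in \<open>'k\<close> extended by \<open>+\<infinity>\<close>,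
  for \<open>a, b\<close> nonnegative in \<open>ereal\<close>, with \<open>\<gamma> \<cdot> (+\<infinity>) = +\<infinity>\<close>.
\<close>

definition scaled_le :: "'k::{linordered_field, real_algebra_1} \<Rightarrow> ereal \<Rightarrow> ereal \<Rightarrow> bool" where
  "scaled_le \<gamma> a b \<longleftrightarrow>
     b = \<infinity> \<or> a < \<infinity> \<and> of_real (real_of_ereal a) \<le> \<gamma> * of_real (real_of_ereal b)"

definition component_map ::
  "'b set \<Rightarrow> ('b \<Rightarrow> 'b \<Rightarrow> ereal) \<Rightarrow> ('a \<Rightarrow> 'b) \<Rightarrow> 'a set \<Rightarrow> 'b set" where
  "component_map F' \<delta>' f E = (THE H. H \<in> metric_components F' \<delta>' \<and> f ` E \<subseteq> H)"

definition galactic_morphism ::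
  "'a set \<Rightarrow> ('a \<Rightarrow> 'a \<Rightarrow> ereal) \<Rightarrow> ('a set \<Rightarrow> 'a set \<Rightarrow> 'k::{linordered_field, real_algebra_1} galaxy) \<Rightarrow>
   'b set \<Rightarrow> ('b \<Rightarrow> 'b \<Rightarrow> ereal) \<Rightarrow> ('b set \<Rightarrow> 'b set \<Rightarrow> 'k galaxy) \<Rightarrow> ('a \<Rightarrow> 'b) \<Rightarrow> bool" where
  "galactic_morphism F \<delta> \<Delta> F' \<delta>' \<Delta>' f \<longleftrightarrow>
     galactic_space F \<delta> \<Delta> \<and> galactic_space F' \<delta>' \<Delta>' \<and> f ` F \<subseteq> F' \<and>
     (\<exists>\<gamma>::'k. limited \<gamma> \<and> \<gamma> > 0 \<and>
        (\<forall>x1\<in>F. \<forall>x2\<in>F. scaled_le \<gamma> (\<delta>' (f x1) (f x2)) (\<delta> x1 x2)) \<and>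
        (\<forall>E1\<in>metric_components F \<delta>. \<forall>E2\<in>metric_components F \<delta>.
           \<Delta>' (component_map F' \<delta>' f E1) (component_map F' \<delta>' f E2) \<le> \<gamma> \<bullet>\<^sub>G \<Delta> E1 E2))"

definition galactic_contraction ::
  "'k::{linordered_field, real_algebra_1} \<Rightarrow>
   'a set \<Rightarrow> ('a \<Rightarrow> 'a \<Rightarrow> ereal) \<Rightarrow> ('a set \<Rightarrow> 'a set \<Rightarrow> 'k galaxy) \<Rightarrow>
   'b set \<Rightarrow> ('b \<Rightarrow> 'b \<Rightarrow> ereal) \<Rightarrow> ('b set \<Rightarrow> 'b set \<Rightarrow> 'k galaxy) \<Rightarrow> ('a \<Rightarrow> 'b) \<Rightarrow> bool" where
  "galactic_contraction \<gamma> F \<delta> \<Delta> F' \<delta>' \<Delta>' f \<longleftrightarrow>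
     galactic_morphism F \<delta> \<Delta> F' \<delta>' \<Delta>' f \<and> f ` F = F' \<and>
     (\<forall>x1\<in>F. \<forall>x2\<in>F.
        (\<delta> x1 x2 < \<infinity> \<longrightarrow> \<delta>' (f x1) (f x2) = pv (\<gamma> * of_real (real_of_ereal (\<delta> x1 x2)))) \<and>
        (\<delta> x1 x2 = \<infinity> \<longrightarrow> \<delta>' (f x1) (f x2) =
           pv_set (gal_mult_set \<gamma> (\<Delta> (component_of_point F \<delta> x1) (component_of_point F \<delta> x2))))) \<and>
     (\<forall>E1\<in>metric_components F \<delta>. \<forall>E2\<in>metric_components F \<delta>.
        \<Delta>' (component_map F' \<delta>' f E1) (component_map F' \<delta>' f E2) = \<gamma> \<bullet>\<^sub>G \<Delta> E1 E2)"

end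

theory Submission
  imports Defs
begin

text \<open>
  On pairs at finite distance \<open>f\<close> multiplies \<open>\<delta>\<close> by the real number \<open>standard_part \<gamma>\<close>, which
  vanishes exactly if \<open>\<gamma> \<simeq> 0\<close>; in that case \<open>f\<close> is constant on the balls of radius \<open>\<infinity>\<close>. If
  \<open>\<gamma>\<close> is not infinitely small, pairs at infinite distance stay at infinite distance. On metric
  components \<open>\<Delta>\<close> is multiplied by \<open>\<gamma>\<close>, which is continuous because every positive galaxy can be
  halved, and invertible if \<open>1 / \<gamma>\<close> is limited. If \<open>\<gamma> \<simeq> 0\<close>, then \<open>Gal (1 / \<gamma>)\<close> is positive, and
  multiplication by \<open>\<gamma>\<close> annihilates all smaller nonnegative galaxies.
\<close>

section \<open>Real and infinitely small elements\<close>

lemma of_real_less_iff_ordered_extension: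
  "(of_real a :: 'k::{linordered_field, real_algebra_1}) < of_real b \<longleftrightarrow> a < b"
  by (simp add: less_le of_real_le_iff_ordered_extension)

lemma abs_of_real_ordered_extension:
  "\<bar>of_real a :: 'k::{linordered_field, real_algebra_1}\<bar> = of_real \<bar>a\<bar>"
  using of_real_le_iff_ordered_extension[of 0 a, where 'k='k]
    of_real_le_iff_ordered_extension[of a 0, where 'k='k]
  by (cases "0 \<le> a") auto

text \<open>\<open>of_real\<close> respects products, so the quotient is identified by multiplying
  with the nonzero \<open>of_nat n\<close>.\<close>

lemma of_real_inverse_of_nat:
  assumes "n \<ge> 1"
  shows "(of_real (1 / of_nat n) :: 'k::{linordered_field, real_algebra_1}) = 1 / of_nat n"
proof -
  have "(of_real (1 / of_nat n) :: 'k) * of_real (of_nat n) = of_real (1 / of_nat n * of_nat n)"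
    by (simp only: of_real_mult)
  also have "\<dots> = 1"
    using assms by simp
  finally show ?thesis
    using assms by (simp add: eq_divide_eq)
qed

lemma limited_of_real [simp]: "limited (of_real a :: 'k::{linordered_field, real_algebra_1})"
proof -
  obtain n :: nat where "\<bar>a\<bar> \<le> of_nat n"
    using real_arch_simple by blast
  then have "\<bar>of_real a :: 'k\<bar> \<le> of_real (of_nat n)"
    unfolding abs_of_real_ordered_extension of_real_le_iff_ordered_extension .
  then show ?thesis
    by (auto simp: limited_iff)
qed

text \<open>The reals are Archimedean, so the bounds \<open>1 / n\<close> are cofinal among all
  positive real tolerances. Later estimates can then use an arbitrary real \<open>e\<close>.\<close>

lemma infinitely_small_iff_of_real:
  fixes s :: "'k::{linordered_field, real_algebra_1}"
  shows "infinitely_small s \<longleftrightarrow> (\<forall>e>0. \<bar>s\<bar> < of_real e)"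
proof
  assume s: "infinitely_small s"
  show "\<forall>e>0. \<bar>s\<bar> < of_real e"
  proof (intro allI impI)
    fix e :: real assume "e > 0"
    then obtain n :: nat where n: "n \<ge> 1" "1 / of_nat n < e"
      by (metis One_nat_def Suc_leI gr0I nat_approx_posE of_nat_0_less_iff zero_less_Suc)
    have "\<bar>s\<bar> < of_real (1 / of_nat n)"
      using s n(1) by (simp only: of_real_inverse_of_nat infinitely_small_def)
    also have "\<dots> < of_real e"
      using n(2) by (simp only: of_real_less_iff_ordered_extension)
    finally show "\<bar>s\<bar> < of_real e" .
  qed
next
  assume s: "\<forall>e>0. \<bar>s\<bar> < of_real e"
  show "infinitely_small s"
    unfolding infinitely_small_def
  proof (intro allI impI)
    fix n :: nat assume "n \<ge> 1"
    then show "\<bar>s\<bar> < 1 / of_nat n"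
      using s[rule_format, of "1 / of_nat n"] by (simp only: of_real_inverse_of_nat) simp
  qed
qed

lemma infinitely_small_mult_of_real:
  fixes s :: "'k::{linordered_field, real_algebra_1}"
  assumes "infinitely_small s"
  shows "infinitely_small (s * of_real a)"
  unfolding infinitely_small_iff_of_real
proof (intro allI impI)
  fix e :: real assume e: "e > 0"
  \<comment> \<open>Adding 1 keeps \<open>b\<close> positive for \<open>a = 0\<close>, so that
    \<open>e / b\<close> is a legitimate tolerance.\<close>
  define b where "b = \<bar>a\<bar> + 1"
  have b: "b > 0" "\<bar>a\<bar> < b"
    by (auto simp: b_def)
  have "\<bar>s\<bar> < of_real (e / b)"
    using assms e b by (simp add: infinitely_small_iff_of_real)
  moreover have "\<bar>of_real a :: 'k\<bar> < of_real b"
    using b by (simp add: abs_of_real_ordered_extension of_real_less_iff_ordered_extension)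
  ultimately have "\<bar>s\<bar> * \<bar>of_real a\<bar> < of_real (e / b) * of_real b"
    by (intro mult_strict_mono') auto
  also have "\<dots> = of_real e"
    using b by (simp flip: of_real_mult)
  finally show "\<bar>s * of_real a\<bar> < of_real e"
    by (simp add: abs_mult)
qed

text \<open>A bound \<open>n\<close> for the absolute value of \<open>1 / s\<close> is the same as a
  lower bound \<open>1 / n\<close> for that of \<open>s\<close>.\<close>

lemma limited_inverse_iff:
  fixes s :: "'k::linordered_field"
  assumes "s \<noteq> 0"
  shows "limited (1 / s) \<longleftrightarrow> \<not> infinitely_small s"
proof
  assume "limited (1 / s)"
  then obtain n :: nat where n: "\<bar>1 / s\<bar> \<le> of_nat n"
    by (auto simp: limited_iff)
  have "n \<ge> 1"
    using n assms by (cases n) auto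
  moreover have "1 / of_nat n \<le> \<bar>s\<bar>"
    using n assms \<open>n \<ge> 1\<close> by (simp add: abs_divide field_simps)
  ultimately show "\<not> infinitely_small s"
    by (auto simp: infinitely_small_def not_less)
next
  assume "\<not> infinitely_small s"
  then obtain n :: nat where "n \<ge> 1" "1 / of_nat n \<le> \<bar>s\<bar>"
    by (auto simp: infinitely_small_def not_less)
  then have "\<bar>1 / s\<bar> \<le> of_nat n"
    using assms by (simp add: abs_divide field_simps)
  then show "limited (1 / s)"
    by (auto simp: limited_iff)
qed

section \<open>Standard parts and principal values\<close>

text \<open>Completeness of the reals: the reals below \<open>s\<close> form a nonempty set bounded
  above, and its supremum differs from \<open>s\<close> by less than every positive real.\<close>

lemma standard_part_exists:
  fixes s :: "'k::{linordered_field, real_algebra_1}"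
  assumes "limited s"
  shows "\<exists>r. s \<simeq> of_real r"
proof -
  obtain n :: nat where n: "\<bar>s\<bar> \<le> of_nat n"
    using assms by (auto simp: limited_iff)
  define S where "S = {r. of_real r \<le> s}"
  have "- of_nat n \<in> S"
    using n by (simp add: S_def abs_le_iff)
  then have ne: "S \<noteq> {}" by blast
  have "r \<le> of_nat n" if "r \<in> S" for r
  proof -
    have "(of_real r :: 'k) \<le> of_real (of_nat n)"
      using that n by (auto simp: S_def abs_le_iff)
    then show ?thesis
      by (simp only: of_real_le_iff_ordered_extension)
  qed
  then have bdd: "bdd_above S" by (auto simp: bdd_above_def)
  have "infinitely_small (s - of_real (Sup S))"
    unfolding infinitely_small_iff_of_real
  proof (intro allI impI)
    fix e :: real assume e: "e > 0"
    obtain a where a: "a \<in> S" "Sup S - e < a"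
      using less_cSupE[OF _ ne, of "Sup S - e"] e by auto
    have "of_real (Sup S - e) < (of_real a :: 'k)"
      using a by (simp only: of_real_less_iff_ordered_extension)
    then have lower: "of_real (Sup S) - of_real e < s"
      using a by (simp add: S_def)
    have "Sup S + e / 2 \<notin> S"
      using cSup_upper[OF _ bdd, of "Sup S + e / 2"] e by auto
    then have "s < of_real (Sup S + e / 2)"
      by (simp add: S_def not_le)
    also have "\<dots> < of_real (Sup S + e)"
      using e by (simp only: of_real_less_iff_ordered_extension)
    finally show "\<bar>s - of_real (Sup S)\<bar> < of_real e"
      using lower by (simp add: abs_less_iff algebra_simps)
  qed
  then show ?thesis
    by (auto simp: infinitely_close_def)
qed

lemma standard_part_unique:
  fixes s :: "'k::{linordered_field, real_algebra_1}"
  assumes "s \<simeq> of_real a" "s \<simeq> of_real b"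
  shows "a = b"
proof (rule ccontr)
  assume "a \<noteq> b"
  \<comment> \<open>Both reals lie within half their distance from \<open>s\<close>, which
    contradicts the triangle inequality.\<close>
  define e where "e = \<bar>a - b\<bar> / 2"
  have "e > 0"
    using \<open>a \<noteq> b\<close> by (simp add: e_def)
  then have *: "\<bar>s - of_real a\<bar> < of_real e" "\<bar>s - of_real b\<bar> < of_real e"
    using assms by (auto simp: infinitely_close_def infinitely_small_iff_of_real)
  have "\<bar>of_real (a - b) :: 'k\<bar> \<le> \<bar>s - of_real a\<bar> + \<bar>s - of_real b\<bar>"
    using abs_triangle_ineq4[of "s - of_real b" "s - of_real a"] by simp
  also have "\<dots> < of_real (e + e)"
    using * by (simp add: add_strict_mono)
  finally show False
    unfolding abs_of_real_ordered_extension of_real_less_iff_ordered_extension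
    by (simp add: e_def)
qed

lemma standard_part_eqI: "s \<simeq> of_real r \<Longrightarrow> standard_part s = r"
  unfolding standard_part_def by (blast intro: standard_part_unique)

lemma infinitely_close_standard_part:
  "limited s \<Longrightarrow> s \<simeq> of_real (standard_part s)"
  using standard_part_exists standard_part_eqI by metis

text \<open>The infinitely small error \<open>s - of_real (standard_part s)\<close> remains
  infinitely small after multiplication by a real.\<close>

lemma standard_part_mult_of_real:
  assumes "limited s"
  shows "standard_part (s * of_real a) = standard_part s * a"
proof (rule standard_part_eqI)
  show "s * of_real a \<simeq> of_real (standard_part s * a)"
    using infinitely_small_mult_of_real[of "s - of_real (standard_part s)" a]
      infinitely_close_standard_part[OF assms]
    by (simp add: infinitely_close_def algebra_simps)
qed

lemma pv_mult_of_real: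
  assumes "limited s"
  shows "pv (s * of_real a) = ereal (standard_part s * a)"
  using assms by (simp add: pv_def limited_mult standard_part_mult_of_real)

lemma standard_part_nonneg:
  assumes "limited s" "s \<ge> 0"
  shows "standard_part s \<ge> 0"
proof (rule ccontr)
  assume neg: "\<not> standard_part s \<ge> 0"
  \<comment> \<open>A negative standard part supplies its own tolerance: being that close to it
    forces \<open>s < 0\<close>.\<close>
  then have "\<bar>s - of_real (standard_part s)\<bar> < of_real (- standard_part s)"
    using infinitely_close_standard_part[OF assms(1)]
    unfolding infinitely_close_def infinitely_small_iff_of_real
    by (auto simp del: of_real_minus)
  then show False
    using assms(2) by (simp add: abs_less_iff)
qed

lemma standard_part_eq_0_iff:
  assumes "limited s"
  shows "standard_part s = 0 \<longleftrightarrow> infinitely_small s"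
  using infinitely_close_standard_part[OF assms] standard_part_eqI[of s 0]
  by (auto simp: infinitely_close_def)

text \<open>A limited element outside the reals differs from its standard part by a nonzero
  infinitely small element, whose reciprocal is infinitely large.\<close>

lemma exists_not_limited:
  assumes "proper_real_extension TYPE('k::{linordered_field, real_algebra_1})"
  shows "\<exists>s::'k. \<not> limited s"
proof -
  obtain s :: 'k where s: "s \<notin> range of_real"
    using assms by (auto simp: proper_real_extension_def)
  show ?thesis
  proof (cases "limited s")
    case True
    then obtain r where "infinitely_small (s - of_real r)"
      using standard_part_exists by (auto simp: infinitely_close_def)
    moreover have "s - of_real r \<noteq> 0"
      using s by auto
    ultimately have "\<not> limited (1 / (s - of_real r))"
      by (simp add: limited_inverse_iff)
    then show ?thesis ..
  qed blast
qed

section \<open>Scaling of galaxies\<close>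

lemma zero_eq_Gal: "0 = Gal 0"
  by (rule zero_galaxy.abs_eq)

lemma Gal_less_iff: "Gal s < Gal t \<longleftrightarrow> s < t \<and> \<not> limited (t - s)"
  by (metis Gal_le_iff limited_diff_commute linorder_not_le)

lemma limited_divide_2_iff: "limited (s / 2) \<longleftrightarrow> limited (s :: 'k::linordered_field)"
  using limited_add[of "s / 2" "s / 2"] limited_between[of 0 s "s / 2"]
    limited_between[of s 0 "s / 2"] limited_0
  by (cases "s \<ge> 0") auto

text \<open>Here properness enters: it provides a radius for balls of galactic distances, which
  \<open>pos_radius\<close> below requires.\<close>

lemma exists_pos_galaxy:
  assumes "proper_real_extension TYPE('k::{linordered_field, real_algebra_1})"
  shows "\<exists>\<tau>::'k galaxy. \<tau> > 0"
proof -
  obtain s :: 'k where s: "\<not> limited s"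
    using exists_not_limited[OF assms] ..
  then have "s \<noteq> 0" by auto
  then have "Gal \<bar>s\<bar> > 0"
    using s by (simp add: zero_eq_Gal Gal_less_iff abs_if)
  then show ?thesis ..
qed

lemma gal_scale_0: "limited \<gamma> \<Longrightarrow> \<gamma> \<bullet>\<^sub>G 0 = 0"
  by (simp add: zero_eq_Gal gal_scale_Gal)

lemma gal_scale_inverse:
  assumes "limited \<gamma>" "limited (1 / \<gamma>)" "\<gamma> \<noteq> 0"
  shows "(1 / \<gamma>) \<bullet>\<^sub>G (\<gamma> \<bullet>\<^sub>G \<tau>) = \<tau>"
  using assms by (simp add: gal_scale_def[of \<gamma>] gal_scale_Gal)

text \<open>Scaling need not preserve strict inequalities, because an infinitely small
  \<open>\<gamma>\<close> can merge distinct galaxies. Aiming at \<open>r / 2\<close> instead of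
  \<open>r\<close> restores strictness: \<open>Gal (r / 2) < Gal r\<close>, since
  \<open>r / 2\<close> is not limited.\<close>

lemma gal_scale_continuous:
  assumes "limited \<gamma>" "\<gamma> > 0" "\<rho> > 0"
  shows "\<exists>\<sigma>>0. \<forall>\<tau><\<sigma>. \<gamma> \<bullet>\<^sub>G \<tau> < \<rho>"
proof -
  obtain r where r: "\<rho> = Gal r"
    using Gal_rep_galaxy by metis
  have pos: "r > 0" "\<not> limited r"
    using assms(3) by (auto simp: r zero_eq_Gal Gal_less_iff)
  define \<sigma> where "\<sigma> = Gal (r / 2 / \<gamma>)"
  \<comment> \<open>Otherwise multiplication by the limited \<open>\<gamma>\<close> would make
    \<open>r / 2\<close> limited.\<close>
  have "\<not> limited (r / 2 / \<gamma>)"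
    using limited_mult[OF assms(1), of "r / 2 / \<gamma>"] assms(2) pos(2)
    by (auto simp: limited_divide_2_iff)
  then have "\<sigma> > 0"
    using pos assms(2) by (simp add: \<sigma>_def zero_eq_Gal Gal_less_iff)
  moreover have "\<gamma> \<bullet>\<^sub>G \<tau> < \<rho>" if "\<tau> < \<sigma>" for \<tau>
  proof -
    obtain t where t: "\<tau> = Gal t"
      using Gal_rep_galaxy by metis
    have "t < r / 2 / \<gamma>"
      using that by (simp add: \<sigma>_def t Gal_less_iff)
    then have "\<gamma> * t \<le> r / 2"
      using assms(2) by (simp add: field_simps)
    then have "\<gamma> \<bullet>\<^sub>G \<tau> \<le> Gal (r / 2)"
      by (simp add: t gal_scale_Gal[OF assms(1)] Gal_le_iff)
    also have "\<dots> < \<rho>"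
      using pos by (simp add: r Gal_less_iff limited_divide_2_iff)
    finally show ?thesis .
  qed
  ultimately show ?thesis by blast
qed

text \<open>A nonnegative representative \<open>t\<close> of such a galaxy satisfies
  \<open>0 \<le> \<gamma> * t \<le> 1\<close>, so \<open>\<gamma> * t\<close> is limited.\<close>

lemma gal_scale_eq_0_below_inverse:
  assumes "limited \<gamma>" "\<gamma> > 0" "0 \<le> \<tau>" "\<tau> < Gal (1 / \<gamma>)"
  shows "\<gamma> \<bullet>\<^sub>G \<tau> = 0"
proof -
  obtain t where t: "\<tau> = Gal t"
    using Gal_rep_galaxy by metis
  show ?thesis
  proof (cases "t \<ge> 0")
    case True
    have "t < 1 / \<gamma>"
      using assms(4) by (simp add: t Gal_less_iff)
    then have "\<gamma> * t \<le> 1"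
      using assms(2) by (simp add: field_simps)
    moreover have "limited (1 :: 'a)"
      unfolding limited_iff by (rule exI[of _ 1]) simp
    ultimately have "limited (\<gamma> * t)"
      using True assms(2) by (intro limited_between[of 0 1 "\<gamma> * t"]) auto
    then show ?thesis
      by (simp add: t gal_scale_Gal[OF assms(1)] zero_eq_Gal Gal_eq_iff)
  next
    case False
    \<comment> \<open>A nonnegative galaxy has a negative representative only if that representative
      is limited.\<close>
    then have "\<tau> = 0"
      using assms(3) by (auto simp: t zero_eq_Gal Gal_le_iff Gal_eq_iff)
    then show ?thesis
      using assms(1) by (simp add: gal_scale_0)
  qed
qed

text \<open>All elements of a positive galaxy are positive and infinitely large. They stay so after
  multiplication by \<open>\<gamma>\<close>, as multiplying back by the limited
  \<open>1 / \<gamma>\<close> shows.\<close>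

lemma pv_set_gal_mult_set_infinite:
  assumes "limited (1 / \<gamma>)" "\<gamma> > 0" "\<tau> > 0"
  shows "pv_set (gal_mult_set \<gamma> \<tau>) = \<infinity>"
proof -
  have "pv (\<gamma> * s) = \<infinity>" if "Gal s = \<tau>" for s
  proof -
    have s: "s > 0" "\<not> limited s"
      using assms(3) that by (auto simp: zero_eq_Gal Gal_less_iff)
    have "\<not> limited (\<gamma> * s)"
      using limited_mult[OF assms(1), of "\<gamma> * s"] s assms(2) by auto
    then show ?thesis
      using s assms(2) by (simp add: pv_def)
  qed
  \<comment> \<open>Nonemptiness of the galaxy makes the image under \<open>pv\<close> a singleton
    instead of the empty set.\<close>
  moreover have "\<exists>s. Gal s = \<tau>"
    using Gal_rep_galaxy by blast
  ultimately have "pv ` gal_mult_set \<gamma> \<tau> = {\<infinity>}"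
    by (force simp: gal_mult_set_def)
  then show ?thesis
    unfolding pv_set_def by (intro the_equality) auto
qed

section \<open>Topologies defined by distances\<close>

text \<open>
  The gap condition makes every ball a neighbourhood of each of its points. Without the existence
  of a positive radius there would be no balls, and \<open>X\<close> would not be open.
\<close>

locale distance_with_gaps =
  fixes X :: "'a set" and d :: "'a \<Rightarrow> 'a \<Rightarrow> 'g::{comm_monoid_add, linorder}"
  assumes metric_rule: "general_metric_rule X d"
    and gap: "\<And>a r :: 'g. 0 \<le> a \<Longrightarrow> a < r \<Longrightarrow> \<exists>s>0. \<forall>b<s. a + b < r"
    and pos_radius: "\<exists>r::'g. r > 0"
begin

lemma dist_self: "x \<in> X \<Longrightarrow> d x x = 0"
  using metric_rule by (auto simp: general_metric_rule_def)

lemma dist_nonneg: "x \<in> X \<Longrightarrow> y \<in> X \<Longrightarrow> 0 \<le> d x y"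
  using metric_rule by (auto simp: general_metric_rule_def)

lemma dist_pos: "x \<in> X \<Longrightarrow> y \<in> X \<Longrightarrow> x \<noteq> y \<Longrightarrow> 0 < d x y"
  using metric_rule by (auto simp: general_metric_rule_def)

lemma dist_triangle: "x \<in> X \<Longrightarrow> y \<in> X \<Longrightarrow> z \<in> X \<Longrightarrow> d x z \<le> d x y + d y z"
  using metric_rule by (auto simp: general_metric_rule_def)

text \<open>Basis balls may be centred anywhere; \<open>gap\<close> and the triangle inequality
  yield a smaller ball centred at the given point.\<close>

lemma openin_distance_topology_iff:
  "openin (distance_topology X d) U \<longleftrightarrow>
     U \<subseteq> X \<and> (\<forall>x\<in>U. \<exists>r>0. \<forall>y\<in>X. d x y < r \<longrightarrow> y \<in> U)"
proof -
  have base: "openin (distance_topology X d) = arbitrary union_of is_open_ball X d"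
    by (rule openin_distance_topology_aux[OF metric_rule gap])
  show ?thesis
    unfolding base arbitrary_union_of_alt
  proof (intro iffI conjI ballI)
    assume U: "\<forall>x\<in>U. \<exists>B. is_open_ball X d B \<and> x \<in> B \<and> B \<subseteq> U"
    show "U \<subseteq> X"
      using U by (force simp: is_open_ball_def)
    fix x assume "x \<in> U"
    then obtain c r where c: "c \<in> X" "x \<in> X" "d c x < r" and sub: "{y \<in> X. d c y < r} \<subseteq> U"
      using U by (auto simp: is_open_ball_def)
    obtain s where s: "s > 0" "\<forall>b<s. d c x + b < r"
      using gap[OF dist_nonneg[OF c(1,2)] c(3)] by blast
    have "y \<in> U" if "y \<in> X" "d x y < s" for y
      using that sub s(2) dist_triangle[OF c(1,2) that(1)] by (blast intro: le_less_trans)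
    with s(1) show "\<exists>r>0. \<forall>y\<in>X. d x y < r \<longrightarrow> y \<in> U" by blast
  next
    assume U: "U \<subseteq> X \<and> (\<forall>x\<in>U. \<exists>r>0. \<forall>y\<in>X. d x y < r \<longrightarrow> y \<in> U)"
    fix x assume x: "x \<in> U"
    with U obtain r where r: "r > 0" "\<forall>y\<in>X. d x y < r \<longrightarrow> y \<in> U" by blast
    have "is_open_ball X d {y \<in> X. d x y < r}"
      using x U r(1) by (auto simp: is_open_ball_def)
    moreover have "x \<in> {y \<in> X. d x y < r}" "{y \<in> X. d x y < r} \<subseteq> U"
      using x U r dist_self by auto
    ultimately show "\<exists>B. is_open_ball X d B \<and> x \<in> B \<and> B \<subseteq> U" by blast
  qed
qed

lemma topspace_distance_topology: "topspace (distance_topology X d) = X"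
proof (rule antisym)
  have "openin (distance_topology X d) (topspace (distance_topology X d))"
    by simp
  then show "topspace (distance_topology X d) \<subseteq> X"
    by (simp only: openin_distance_topology_iff)
  have "openin (distance_topology X d) X"
    using pos_radius by (simp add: openin_distance_topology_iff)
  then show "X \<subseteq> topspace (distance_topology X d)"
    by (rule openin_subset)
qed

end

lemma continuous_map_distance_topology:
  assumes X: "distance_with_gaps X d" and Y: "distance_with_gaps Y e"
    and maps: "f ` X \<subseteq> Y"
    and cont: "\<And>x r. x \<in> X \<Longrightarrow> r > 0 \<Longrightarrow> \<exists>s>0. \<forall>y\<in>X. d x y < s \<longrightarrow> e (f x) (f y) < r"
  shows "continuous_map (distance_topology X d) (distance_topology Y e) f"
proof -
  interpret X: distance_with_gaps X d by (rule X)
  interpret Y: distance_with_gaps Y e by (rule Y)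
  have "openin (distance_topology X d) {x \<in> X. f x \<in> V}" if V: "openin (distance_topology Y e) V" for V
    unfolding X.openin_distance_topology_iff
  proof (intro conjI ballI)
    fix x assume x: "x \<in> {x \<in> X. f x \<in> V}"
    then obtain r where r: "r > 0" "\<forall>y\<in>Y. e (f x) y < r \<longrightarrow> y \<in> V"
      using V unfolding Y.openin_distance_topology_iff by blast
    obtain s where "s > 0" "\<forall>y\<in>X. d x y < s \<longrightarrow> e (f x) (f y) < r"
      using cont[of x r] x r(1) by blast
    then show "\<exists>s>0. \<forall>y\<in>X. d x y < s \<longrightarrow> y \<in> {x \<in> X. f x \<in> V}"
      using r(2) maps by blast
  qed blast
  then show ?thesis
    using maps by (auto simp: continuous_map_def X.topspace_distance_topology
        Y.topspace_distance_topology)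
qed

text \<open>Injectivity is a consequence of \<open>cont_inv\<close> for the radius \<open>d x y\<close>.\<close>

lemma homeomorphic_map_distance_topology:
  fixes d :: "'a \<Rightarrow> 'a \<Rightarrow> 'g::{comm_monoid_add, linorder}"
  assumes X: "distance_with_gaps X d" and Y: "distance_with_gaps Y e"
    and surj: "f ` X = Y"
    and cont: "\<And>x r. x \<in> X \<Longrightarrow> r > 0 \<Longrightarrow> \<exists>s>0. \<forall>y\<in>X. d x y < s \<longrightarrow> e (f x) (f y) < r"
    and cont_inv: "\<And>x r. x \<in> X \<Longrightarrow> r > 0 \<Longrightarrow> \<exists>s>0. \<forall>y\<in>X. e (f x) (f y) < s \<longrightarrow> d x y < r"
  shows "homeomorphic_map (distance_topology X d) (distance_topology Y e) f"
proof -
  interpret X: distance_with_gaps X d by (rule X)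
  interpret Y: distance_with_gaps Y e by (rule Y)
  have inj: "inj_on f X"
  proof (rule inj_onI, rule ccontr)
    fix x y assume xy: "x \<in> X" "y \<in> X" "f x = f y" "x \<noteq> y"
    obtain s where s: "s > 0" "\<forall>z\<in>X. e (f x) (f z) < s \<longrightarrow> d x z < d x y"
      using cont_inv[OF xy(1) X.dist_pos[OF xy(1,2,4)]] by blast
    have "e (f x) (f y) = 0"
      using xy surj Y.dist_self by auto
    then show False
      using s xy(2) by (metis less_irrefl)
  qed
  define g where "g = inv_into X f"
  have gf: "g (f x) = x" if "x \<in> X" for x
    using inj that by (simp add: g_def)
  have fg: "f (g y) = y" "g y \<in> X" if "y \<in> Y" for y
    using that surj by (auto simp: g_def f_inv_into_f inv_into_into)
  have "continuous_map (distance_topology Y e) (distance_topology X d) g"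
  proof (rule continuous_map_distance_topology[OF Y X])
    show "g ` Y \<subseteq> X"
      using fg by blast
    \<comment> \<open>At \<open>x = g y\<close>, where \<open>f (g y) = y\<close>, the assumption
      \<open>cont_inv\<close> is the continuity condition for \<open>g\<close>.\<close>
    fix y r assume "y \<in> Y" "r > (0::'g)"
    then show "\<exists>s>0. \<forall>z\<in>Y. e y z < s \<longrightarrow> d (g y) (g z) < r"
      using cont_inv[of "g y" r] fg by metis
  qed
  moreover have "continuous_map (distance_topology X d) (distance_topology Y e) f"
    by (rule continuous_map_distance_topology[OF X Y _ cont]) (use surj in auto)
  ultimately have "homeomorphic_maps (distance_topology X d) (distance_topology Y e) f g"
    by (simp add: homeomorphic_maps_def X.topspace_distance_topology
        Y.topspace_distance_topology gf fg)
  then show ?thesis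
    by (auto simp: homeomorphic_map_maps)
qed

lemma distance_with_gaps_generalized:
  assumes "generalized_distance F \<delta>"
  shows "distance_with_gaps F \<delta>"
proof
  show "general_metric_rule F \<delta>"
    using assms by (simp add: generalized_distance_def)
  show "\<exists>s>0. \<forall>b<s. a + b < r" if "0 \<le> a" "a < r" for a r :: ereal
  \<comment> \<open>Here \<open>a\<close> is finite because \<open>0 \<le> a < r\<close>, so
    \<open>r - a\<close> is a valid gap even for \<open>r = \<infinity>\<close>, where it equals
    \<open>\<infinity>\<close>.\<close>
  proof (intro exI[of _ "r - a"] conjI allI impI)
    show "r - a > 0" using that by (cases a; cases r) auto
    show "a + b < r" if "b < r - a" for b
      using that \<open>0 \<le> a\<close> \<open>a < r\<close> by (cases a; cases b; cases r) auto
  qed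
  show "\<exists>r::ereal. r > 0"
    by (rule exI[of _ 1]) simp
qed

lemma distance_with_gaps_galactic:
  fixes \<Delta> :: "'a \<Rightarrow> 'a \<Rightarrow> 'k::{linordered_field, real_algebra_1} galaxy"
  assumes "proper_real_extension TYPE('k)" and "galactic_distance X \<Delta>"
  shows "distance_with_gaps X \<Delta>"
proof
  show "general_metric_rule X \<Delta>"
    using assms by (simp add: galactic_distance_def)
  show "\<exists>s>0. \<forall>b<s. a + b < r" if "a < r" for a r :: "'k galaxy"
    using that by (intro exI[of _ "r - a"]) (auto simp: less_diff_eq add.commute)
  show "\<exists>r::'k galaxy. r > 0"
    by (rule exists_pos_galaxy[OF assms(1)])
qed

section \<open>Contractions\<close>

lemma component_of_point_in_metric_components:
  "x \<in> F \<Longrightarrow> component_of_point F \<delta> x \<in> metric_components F \<delta>"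
  by (auto simp: component_of_point_def metric_components_def quotientI)

lemma metric_components_cases:
  assumes "E \<in> metric_components F \<delta>"
  obtains x where "x \<in> F" "E = component_of_point F \<delta> x"
  using assms by (auto simp: component_of_point_def metric_components_def elim: quotientE)

lemma component_of_point_eq_iff:
  assumes "generalized_distance F \<delta>" "x \<in> F" "y \<in> F"
  shows "component_of_point F \<delta> x = component_of_point F \<delta> y \<longleftrightarrow> \<delta> x y < \<infinity>"
  using assms eq_equiv_class_iff[OF equiv_finite_distance_rel[OF assms(1)] assms(2,3)]
  by (simp add: component_of_point_def finite_distance_rel_def)

text \<open>Evaluates the definite description in \<open>component_map\<close>: the image of the
  component of \<open>x\<close> contains \<open>f x\<close>, and only one metric component contains
  \<open>f x\<close>.\<close>

lemma component_map_component_of_point: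
  assumes \<delta>: "generalized_distance F \<delta>" and \<delta>': "generalized_distance F' \<delta>'"
    and maps: "f ` F \<subseteq> F'"
    and finite: "\<And>x y. x \<in> F \<Longrightarrow> y \<in> F \<Longrightarrow> \<delta> x y < \<infinity> \<Longrightarrow> \<delta>' (f x) (f y) < \<infinity>"
    and x: "x \<in> F"
  shows "component_map F' \<delta>' f (component_of_point F \<delta> x) = component_of_point F' \<delta>' (f x)"
  unfolding component_map_def
proof (rule the_equality)
  show "component_of_point F' \<delta>' (f x) \<in> metric_components F' \<delta>' \<and>
      f ` component_of_point F \<delta> x \<subseteq> component_of_point F' \<delta>' (f x)"
    using x maps finite component_of_point_in_metric_components[of "f x" F']
    by (auto simp: component_of_point_def finite_distance_rel_def)
  fix H assume H: "H \<in> metric_components F' \<delta>' \<and> f ` component_of_point F \<delta> x \<subseteq> H"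
  then obtain y where y: "y \<in> F'" "H = component_of_point F' \<delta>' y"
    by (auto elim: metric_components_cases)
  \<comment> \<open>This is the criterion for equal components applied to the trivial
    equality.\<close>
  have "\<delta> x x < \<infinity>"
    using component_of_point_eq_iff[OF \<delta> x x] by simp
  then have "x \<in> component_of_point F \<delta> x"
    using x by (simp add: component_of_point_def finite_distance_rel_def)
  then have "f x \<in> component_of_point F' \<delta>' y"
    using H y by blast
  then have "\<delta>' y (f x) < \<infinity>" "f x \<in> F'"
    by (auto simp: component_of_point_def finite_distance_rel_def)
  then show "H = component_of_point F' \<delta>' (f x)"
    using component_of_point_eq_iff[OF \<delta>'] y by blast
qed

locale contraction =
  fixes \<gamma> :: "'k::{linordered_field, real_algebra_1}"
    and F :: "'a set" and \<delta> :: "'a \<Rightarrow> 'a \<Rightarrow> ereal" and \<Delta> :: "'a set \<Rightarrow> 'a set \<Rightarrow> 'k galaxy"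
    and F' :: "'b set" and \<delta>' :: "'b \<Rightarrow> 'b \<Rightarrow> ereal" and \<Delta>' :: "'b set \<Rightarrow> 'b set \<Rightarrow> 'k galaxy"
    and f :: "'a \<Rightarrow> 'b"
  assumes proper: "proper_real_extension TYPE('k)"
    and \<gamma>_pos: "\<gamma> > 0" and limited_\<gamma>: "limited \<gamma>"
    and contr: "galactic_contraction \<gamma> F \<delta> \<Delta> F' \<delta>' \<Delta>' f"
begin

abbreviation "c \<equiv> standard_part \<gamma>"
abbreviation "M \<equiv> metric_components F \<delta>"
abbreviation "M' \<equiv> metric_components F' \<delta>'"
abbreviation "f_tilde \<equiv> component_map F' \<delta>' f"

lemma distances:
  "generalized_distance F \<delta>" "generalized_distance F' \<delta>'"
  "galactic_distance M \<Delta>" "galactic_distance M' \<Delta>'"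
  using contr by (auto simp: galactic_contraction_def galactic_morphism_def galactic_space_def)

sublocale F: distance_with_gaps F \<delta>
  by (rule distance_with_gaps_generalized[OF distances(1)])

sublocale F': distance_with_gaps F' \<delta>'
  by (rule distance_with_gaps_generalized[OF distances(2)])

sublocale M: distance_with_gaps M \<Delta>
  by (rule distance_with_gaps_galactic[OF proper distances(3)])

sublocale M': distance_with_gaps M' \<Delta>'
  by (rule distance_with_gaps_galactic[OF proper distances(4)])

lemma f_image: "f ` F = F'"
  using contr by (simp add: galactic_contraction_def)

lemma f_in: "x \<in> F \<Longrightarrow> f x \<in> F'"
  using f_image by blast

text \<open>A finite distance is a real number, and \<open>pv\<close> of \<open>\<gamma>\<close>
  times a real is the standard part of \<open>\<gamma>\<close> times that real. In particular the
  image distance is finite.\<close>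

lemma dist_image:
  assumes "x \<in> F" "y \<in> F" "\<delta> x y < \<infinity>"
  shows "\<delta>' (f x) (f y) = ereal (c * real_of_ereal (\<delta> x y))"
  using assms contr limited_\<gamma> by (simp add: galactic_contraction_def pv_mult_of_real)

lemma f_tilde_component_of_point:
  "x \<in> F \<Longrightarrow> f_tilde (component_of_point F \<delta> x) = component_of_point F' \<delta>' (f x)"
  by (rule component_map_component_of_point[OF distances(1,2)])
    (use f_image dist_image in auto)

text \<open>Surjectivity of \<open>f\<close> lets every component of \<open>F'\<close> be
  represented by a point \<open>f x\<close>, hence be the image of the component of
  \<open>x\<close>.\<close>

lemma f_tilde_image: "f_tilde ` M = M'"
proof (intro equalityI subsetI)
  fix H assume "H \<in> f_tilde ` M"
  then show "H \<in> M'"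
    by (auto simp: f_tilde_component_of_point f_in elim!: metric_components_cases
        intro!: component_of_point_in_metric_components)
next
  fix H assume "H \<in> M'"
  then obtain x where "x \<in> F" "H = component_of_point F' \<delta>' (f x)"
    using f_image by (auto elim!: metric_components_cases)
  then show "H \<in> f_tilde ` M"
    using component_of_point_in_metric_components
    by (metis f_tilde_component_of_point image_eqI)
qed

lemma galactic_dist_image:
  "E \<in> M \<Longrightarrow> H \<in> M \<Longrightarrow> \<Delta>' (f_tilde E) (f_tilde H) = \<gamma> \<bullet>\<^sub>G \<Delta> E H"
  using contr by (simp add: galactic_contraction_def)

section \<open>Continuity estimates for a contraction and its inverse\<close>

lemma dist_image_small:
  assumes x: "x \<in> F" and r: "r > 0"
  shows "\<exists>s>0. \<forall>y\<in>F. \<delta> x y < s \<longrightarrow> \<delta>' (f x) (f y) < r"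
proof (cases "r = \<infinity>")
  case True
  \<comment> \<open>Finite distances have finite images, so the radius \<open>\<infinity>\<close>
    serves on both sides.\<close>
  then show ?thesis
    using x by (intro exI[of _ "\<infinity>"]) (auto simp: dist_image)
next
  case False
  with r obtain q where q: "r = ereal q" "q > 0"
    by (cases r) auto
  have c: "c \<ge> 0"
    using standard_part_nonneg limited_\<gamma> \<gamma>_pos by force
  \<comment> \<open>The denominator is \<open>c + 1\<close> because \<open>c\<close> vanishes for
    infinitely small \<open>\<gamma>\<close>.\<close>
  have "\<delta>' (f x) (f y) < r" if y: "y \<in> F" and lt: "\<delta> x y < ereal (q / (c + 1))" for y
  proof -
    obtain a where a: "\<delta> x y = ereal a" "a \<ge> 0"
      using F.dist_nonneg[OF x y] lt by (cases "\<delta> x y") auto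
    have "c * a \<le> (c + 1) * a"
      using a c by (simp add: mult_right_mono)
    also have "\<dots> < q"
      using lt a c by (simp add: field_simps)
    finally show ?thesis
      using dist_image[OF x y] a q by simp
  qed
  then show ?thesis
    using q c by (intro exI[of _ "ereal (q / (c + 1))"]) (auto intro: divide_pos_pos)
qed

lemma galactic_dist_image_small:
  assumes "E \<in> M" "\<rho> > 0"
  shows "\<exists>\<sigma>>0. \<forall>H\<in>M. \<Delta> E H < \<sigma> \<longrightarrow> \<Delta>' (f_tilde E) (f_tilde H) < \<rho>"
  using gal_scale_continuous[OF limited_\<gamma> \<gamma>_pos assms(2)] assms(1) galactic_dist_image by metis

lemma dist_small_of_image_small:
  assumes \<gamma>: "\<not> infinitely_small \<gamma>" and x: "x \<in> F" and r: "r > 0"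
  shows "\<exists>s>0. \<forall>y\<in>F. \<delta>' (f x) (f y) < s \<longrightarrow> \<delta> x y < r"
proof -
  have c: "c > 0"
    using standard_part_nonneg[OF limited_\<gamma>] standard_part_eq_0_iff[OF limited_\<gamma>] \<gamma> \<gamma>_pos
    by (simp add: less_le)
  have inv: "limited (1 / \<gamma>)"
    using limited_inverse_iff[of \<gamma>] \<gamma> \<gamma>_pos by simp
  \<comment> \<open>The radius \<open>ereal c * r\<close> undoes the factor \<open>c > 0\<close>; it
    is \<open>\<infinity>\<close> for \<open>r = \<infinity>\<close>.\<close>
  have "\<delta> x y < r" if y: "y \<in> F" and lt: "\<delta>' (f x) (f y) < ereal c * r" for y
  proof -
    have fin: "\<delta> x y < \<infinity>"
    proof (rule ccontr)
      let ?E = "component_of_point F \<delta> x" and ?H = "component_of_point F \<delta> y"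
      \<comment> \<open>Points in distinct components have positive galactic distance, so their
        images would be infinitely far apart, which the strict bound \<open>lt\<close>
        excludes.\<close>
      assume inf: "\<not> \<delta> x y < \<infinity>"
      then have "?E \<noteq> ?H"
        using component_of_point_eq_iff[OF distances(1) x y] by simp
      then have "\<Delta> ?E ?H > 0"
        using x y by (intro M.dist_pos component_of_point_in_metric_components)
      then have "\<delta>' (f x) (f y) = \<infinity>"
        using contr x y inf pv_set_gal_mult_set_infinite[OF inv \<gamma>_pos]
        by (simp add: galactic_contraction_def)
      then show False
        using lt by simp
    qed
    then obtain a where "\<delta> x y = ereal a"
      using F.dist_nonneg[OF x y] by (cases "\<delta> x y") auto
    then show ?thesis
      using dist_image[OF x y fin] lt c r by (cases r) auto
  qed
  moreover have "ereal c * r > 0"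
    using c r by (cases r) auto
  ultimately show ?thesis by blast
qed

text \<open>Since \<open>1 / \<gamma>\<close> is limited, scaling by it is continuous at 0 as well,
  and it recovers \<open>\<Delta> E H\<close> from its image.\<close>

lemma galactic_dist_small_of_image_small:
  assumes \<gamma>: "\<not> infinitely_small \<gamma>" and E: "E \<in> M" and \<rho>: "\<rho> > 0"
  shows "\<exists>\<sigma>>0. \<forall>H\<in>M. \<Delta>' (f_tilde E) (f_tilde H) < \<sigma> \<longrightarrow> \<Delta> E H < \<rho>"
proof -
  have inv: "limited (1 / \<gamma>)"
    using limited_inverse_iff[of \<gamma>] \<gamma> \<gamma>_pos by simp
  obtain \<sigma> where "\<sigma> > 0" and \<sigma>: "\<forall>\<tau><\<sigma>. (1 / \<gamma>) \<bullet>\<^sub>G \<tau> < \<rho>"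
    using gal_scale_continuous[OF inv _ \<rho>] \<gamma>_pos by auto
  moreover have "\<Delta> E H < \<rho>" if "H \<in> M" "\<Delta>' (f_tilde E) (f_tilde H) < \<sigma>" for H
    using \<sigma>[rule_format, OF that(2)] galactic_dist_image[OF E that(1)] limited_\<gamma> inv \<gamma>_pos
    by (simp add: gal_scale_inverse)
  ultimately show ?thesis by blast
qed

section \<open>Fibres for infinitely small \<open>\<gamma>\<close>\<close>

lemma openin_fibre:
  assumes "infinitely_small \<gamma>"
  shows "openin (distance_topology F \<delta>) {x \<in> F. f x = z}"
  unfolding F.openin_distance_topology_iff
proof (intro conjI ballI)
  fix x assume x: "x \<in> {x \<in> F. f x = z}"
  \<comment> \<open>As \<open>c = 0\<close>, finite distances collapse to 0, so the fibre contains
    the whole metric component of \<open>x\<close>, which is the ball of radius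
    \<open>\<infinity>\<close>.\<close>
  have "f y = z" if "y \<in> F" "\<delta> x y < \<infinity>" for y
  proof (rule ccontr)
    assume "f y \<noteq> z"
    then have "\<delta>' (f x) (f y) > 0"
      using x that f_in by (intro F'.dist_pos) auto
    then show False
      using dist_image x that assms standard_part_eq_0_iff[OF limited_\<gamma>] by auto
  qed
  then show "\<exists>r>0. \<forall>y\<in>F. \<delta> x y < r \<longrightarrow> y \<in> {x \<in> F. f x = z}"
    by (intro exI[of _ "\<infinity>"]) auto
qed blast

lemma openin_fibre_tilde:
  assumes "infinitely_small \<gamma>"
  shows "openin (distance_topology M \<Delta>) {E \<in> M. f_tilde E = Z}"
  unfolding M.openin_distance_topology_iff
proof (intro conjI ballI)
  fix E assume E: "E \<in> {E \<in> M. f_tilde E = Z}"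
  have "\<not> limited (1 / \<gamma>)"
    using limited_inverse_iff[of \<gamma>] assms \<gamma>_pos by simp
  \<comment> \<open>This galaxy is the radius of the ball: below it, all galactic distances from
    \<open>E\<close> are scaled to 0.\<close>
  then have "Gal (1 / \<gamma>) > 0"
    using \<gamma>_pos by (simp add: zero_eq_Gal Gal_less_iff)
  moreover have "f_tilde H = Z" if H: "H \<in> M" "\<Delta> E H < Gal (1 / \<gamma>)" for H
  proof (rule ccontr)
    assume "f_tilde H \<noteq> Z"
    then have "\<Delta>' (f_tilde E) (f_tilde H) > 0"
      using E H f_tilde_image by (intro M'.dist_pos) auto
    moreover have "\<gamma> \<bullet>\<^sub>G \<Delta> E H = 0"
      using E H by (intro gal_scale_eq_0_below_inverse limited_\<gamma> \<gamma>_pos M.dist_nonneg) auto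
    ultimately show False
      using galactic_dist_image E H by auto
  qed
  ultimately show "\<exists>r>0. \<forall>H\<in>M. \<Delta> E H < r \<longrightarrow> H \<in> {E \<in> M. f_tilde E = Z}"
    by blast
qed blast

end

theorem proposition5:
  fixes \<gamma> :: "'k::{linordered_field, real_algebra_1}"
    and F :: "'a set" and \<delta> :: "'a \<Rightarrow> 'a \<Rightarrow> ereal" and \<Delta> :: "'a set \<Rightarrow> 'a set \<Rightarrow> 'k galaxy"
    and F\<^sub>\<gamma> :: "'b set" and \<delta>\<^sub>\<gamma> :: "'b \<Rightarrow> 'b \<Rightarrow> ereal" and \<Delta>\<^sub>\<gamma> :: "'b set \<Rightarrow> 'b set \<Rightarrow> 'k galaxy"
    and f :: "'a \<Rightarrow> 'b"
  defines "T \<equiv> distance_topology F \<delta>"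
    and "T\<^sub>\<gamma> \<equiv> distance_topology F\<^sub>\<gamma> \<delta>\<^sub>\<gamma>"
    and "TM \<equiv> distance_topology (metric_components F \<delta>) \<Delta>"
    and "TM\<^sub>\<gamma> \<equiv> distance_topology (metric_components F\<^sub>\<gamma> \<delta>\<^sub>\<gamma>) \<Delta>\<^sub>\<gamma>"
    and "f_tilde \<equiv> component_map F\<^sub>\<gamma> \<delta>\<^sub>\<gamma> f"
  assumes "proper_real_extension TYPE('k)"
    and "\<gamma> > 0" and "limited \<gamma>"
    and "galactic_space F \<delta> \<Delta>" and "galactic_space F\<^sub>\<gamma> \<delta>\<^sub>\<gamma> \<Delta>\<^sub>\<gamma>"
    and "galactic_contraction \<gamma> F \<delta> \<Delta> F\<^sub>\<gamma> \<delta>\<^sub>\<gamma> \<Delta>\<^sub>\<gamma> f"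
  shows "(continuous_map T T\<^sub>\<gamma> f \<and> continuous_map TM TM\<^sub>\<gamma> f_tilde) \<and>
    (\<not> \<gamma> \<simeq> 0 \<longrightarrow> homeomorphic_map T T\<^sub>\<gamma> f \<and> homeomorphic_map TM TM\<^sub>\<gamma> f_tilde) \<and>
    (\<gamma> \<simeq> 0 \<longrightarrow> (\<forall>z\<in>F\<^sub>\<gamma>. openin T {x \<in> F. f x = z})) \<and>
    (\<gamma> \<simeq> 0 \<and> (\<exists>\<eta>. \<eta> > 0 \<and> \<eta> \<simeq> 0 \<and> \<gamma> / \<eta> \<simeq> 0) \<longrightarrow>
       (\<forall>Z\<in>metric_components F\<^sub>\<gamma> \<delta>\<^sub>\<gamma>. openin TM {E \<in> metric_components F \<delta>. f_tilde E = Z}))"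
proof -
  interpret contraction \<gamma> F \<delta> \<Delta> F\<^sub>\<gamma> \<delta>\<^sub>\<gamma> \<Delta>\<^sub>\<gamma> f
    using assms by unfold_locales
  note F = F.distance_with_gaps_axioms F'.distance_with_gaps_axioms
  note M = M.distance_with_gaps_axioms M'.distance_with_gaps_axioms
  have small: "\<gamma> \<simeq> 0 \<longleftrightarrow> infinitely_small \<gamma>"
    by (simp add: infinitely_close_def)
  have "continuous_map T T\<^sub>\<gamma> f"
    unfolding T_def T\<^sub>\<gamma>_def using f_image
    by (intro continuous_map_distance_topology[OF F] dist_image_small) auto
  moreover have "continuous_map TM TM\<^sub>\<gamma> f_tilde"
    unfolding TM_def TM\<^sub>\<gamma>_def f_tilde_def using f_tilde_image
    by (intro continuous_map_distance_topology[OF M] galactic_dist_image_small) auto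
  moreover have "homeomorphic_map T T\<^sub>\<gamma> f" if "\<not> \<gamma> \<simeq> 0"
    unfolding T_def T\<^sub>\<gamma>_def using that
    by (intro homeomorphic_map_distance_topology[OF F] f_image dist_image_small
        dist_small_of_image_small) (simp_all add: small)
  moreover have "homeomorphic_map TM TM\<^sub>\<gamma> f_tilde" if "\<not> \<gamma> \<simeq> 0"
    unfolding TM_def TM\<^sub>\<gamma>_def f_tilde_def using that
    by (intro homeomorphic_map_distance_topology[OF M] f_tilde_image galactic_dist_image_small
        galactic_dist_small_of_image_small) (simp_all add: small)
  ultimately show ?thesis
    unfolding small by (simp add: T_def TM_def f_tilde_def openin_fibre openin_fibre_tilde)
qed

end
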